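(* Let $N\geq 2$, $1<p<\infty$, $m,q>0$, $0\leq\alpha<p-1$, $0\leq\beta\leq m$ and assume $\delta:=(p-1-\alpha)(p-1-\beta)-qm>0$. Then any non-constant global positive radial solution $(u,v)$ of $$\Delta_p u=v^{m}|\nabla u|^{\alpha},\qquad \Delta_p v=v^{\beta}|\nabla u|^{q}\qquad\text{in }\mathbb{R}^N$$ satisfies $$\lim_{|x|\to\infty}\frac{u(x)}{|x|^{1+\frac{p(m+1)-(1+\beta)}{\delta}}}=A\qquad\text{and}\qquad \lim_{|x|\to\infty}\frac{v(x)}{|x|^{\frac{p(p-1-\alpha)+q}{\delta}}}=B,$$ where $A,B\in(0,\infty)$ depend only on $N,p,q,m,\alpha,\beta$ and are given by $$A=\frac{1}{Y_\infty^{\frac{m(p-1)}{\delta}}Z_\infty^{\frac{p-1-\beta}{\delta}}W_\infty^{\frac{m}{\delta}}X_\infty},\qquad B=\frac{1}{Y_\infty^{\frac{(p-1)(p-1-\alpha)}{\delta}}Z_\infty^{\frac{q}{\delta}}W_\infty^{\frac{p-1-\alpha}{\delta}}},$$ with $$Y_\infty=\frac{p(p-1-\alpha)+q}{\delta},\quad Z_\infty=\frac{m(p-1)}{p-1-\alpha}Y_\infty+N+\frac{\alpha}{p-1-\alpha},\quad W_\infty=(p-1)Y_\infty+N-p,\quad X_\infty=\frac{1}{p-1}Z_\infty+\frac{p-N}{p-1}.$$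
   Context: $\Delta_p u=\mathrm{div}(|\nabla u|^{p-2}\nabla u)$ is the $p$-Laplace operator. A non-constant global positive radial solution of the system is a pair $(u,v)$ such that $u,v\in C^2(\mathbb{R}^N)$ are positive and radially symmetric, $u$ and $v$ are not constant in any neighbourhood of the origin, and $u,v$ satisfy the system in all of $\mathbb{R}^N$. *)

theory Defs
  imports "HOL-Analysis.Analysis"
begin

definition grad :: "('a::euclidean_space \<Rightarrow> real) \<Rightarrow> 'a \<Rightarrow> 'a"
  where "grad u x = (THE D. GDERIV u x :> D)"

text \<open>The derivative of the gradient is the Hessian; its continuity gives
  twice continuous differentiability on the whole space.\<close>

definition C2 :: "('a::euclidean_space \<Rightarrow> real) \<Rightarrow> bool"
  where "C2 u \<longleftrightarrow>
    (\<exists>g. \<exists>H :: 'a \<Rightarrow> 'a \<Rightarrow>\<^sub>L 'a.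
       (\<forall>x. GDERIV u x :> g x) \<and>
       (\<forall>x. (g has_derivative blinfun_apply (H x)) (at x)) \<and>
       continuous_on UNIV H)"

text \<open>A relation rather than a function: it includes the existence of the derivative,
  so no junk value enters where the vector field is not differentiable.\<close>

definition has_divergence :: "('a::euclidean_space \<Rightarrow> 'a) \<Rightarrow> real \<Rightarrow> 'a \<Rightarrow> bool"
  where "has_divergence F d x \<longleftrightarrow>
    (\<exists>F'. (F has_derivative F') (at x) \<and> (\<Sum>b\<in>Basis. F' b \<bullet> b) = d)"

text \<open>At critical points of \<open>u\<close> this field is \<open>0\<close>, its continuous extension since \<open>p > 1\<close>.\<close>

definition p_flux :: "real \<Rightarrow> ('a::euclidean_space \<Rightarrow> real) \<Rightarrow> 'a \<Rightarrow> 'a"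
  where "p_flux p u x = (norm (grad u x) powr (p - 2)) *\<^sub>R grad u x"

definition has_p_Laplacian :: "real \<Rightarrow> ('a::euclidean_space \<Rightarrow> real) \<Rightarrow> real \<Rightarrow> 'a \<Rightarrow> bool"
  where "has_p_Laplacian p u d x \<longleftrightarrow> has_divergence (p_flux p u) d x"

text \<open>\<open>|\<nabla>u(x)|\<^sup>a\<close> for \<open>a \<ge> 0\<close>. The library has \<open>0 powr 0 = 0\<close>, whereas a factor with
  exponent \<open>0\<close> must be \<open>1\<close> also at critical points.\<close>

definition grad_pow :: "('a::euclidean_space \<Rightarrow> real) \<Rightarrow> 'a \<Rightarrow> real \<Rightarrow> real"
  where "grad_pow u x a = (if a = 0 then 1 else norm (grad u x) powr a)"

definition solves_system ::
  "real \<Rightarrow> real \<Rightarrow> real \<Rightarrow> real \<Rightarrow> real \<Rightarrow>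
   ('a::euclidean_space \<Rightarrow> real) \<Rightarrow> ('a \<Rightarrow> real) \<Rightarrow> bool"
  where "solves_system p q m \<alpha> \<beta> u v \<longleftrightarrow>
    (\<forall>x. has_p_Laplacian p u (v x powr m * grad_pow u x \<alpha>) x \<and>
         has_p_Laplacian p v (v x powr \<beta> * grad_pow u x q) x)"

definition radially_symmetric :: "('a::euclidean_space \<Rightarrow> real) \<Rightarrow> bool"
  where "radially_symmetric u \<longleftrightarrow> (\<forall>x y. norm x = norm y \<longrightarrow> u x = u y)"

definition nonconstant_near_0 :: "('a::euclidean_space \<Rightarrow> real) \<Rightarrow> bool"
  where "nonconstant_near_0 u \<longleftrightarrow> (\<forall>S. open S \<and> 0 \<in> S \<longrightarrow> \<not> u constant_on S)"

definition nonconstant_global_positive_radial_solution ::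
  "real \<Rightarrow> real \<Rightarrow> real \<Rightarrow> real \<Rightarrow> real \<Rightarrow>
   ('a::euclidean_space \<Rightarrow> real) \<Rightarrow> ('a \<Rightarrow> real) \<Rightarrow> bool"
  where "nonconstant_global_positive_radial_solution p q m \<alpha> \<beta> u v \<longleftrightarrow>
    C2 u \<and> C2 v \<and>
    (\<forall>x. u x > 0) \<and> (\<forall>x. v x > 0) \<and>
    radially_symmetric u \<and> radially_symmetric v \<and>
    nonconstant_near_0 u \<and> nonconstant_near_0 v \<and>
    solves_system p q m \<alpha> \<beta> u v"

definition system_delta :: "real \<Rightarrow> real \<Rightarrow> real \<Rightarrow> real \<Rightarrow> real \<Rightarrow> real"
  where "system_delta p q m \<alpha> \<beta> = (p - 1 - \<alpha>) * (p - 1 - \<beta>) - q * m"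

definition Y_inf :: "real \<Rightarrow> real \<Rightarrow> real \<Rightarrow> real \<Rightarrow> real \<Rightarrow> real"
  where "Y_inf p q m \<alpha> \<beta> = (p * (p - 1 - \<alpha>) + q) / system_delta p q m \<alpha> \<beta>"

definition Z_inf :: "nat \<Rightarrow> real \<Rightarrow> real \<Rightarrow> real \<Rightarrow> real \<Rightarrow> real \<Rightarrow> real"
  where "Z_inf N p q m \<alpha> \<beta> =
    m * (p - 1) / (p - 1 - \<alpha>) * Y_inf p q m \<alpha> \<beta> + real N + \<alpha> / (p - 1 - \<alpha>)"

definition W_inf :: "nat \<Rightarrow> real \<Rightarrow> real \<Rightarrow> real \<Rightarrow> real \<Rightarrow> real \<Rightarrow> real"
  where "W_inf N p q m \<alpha> \<beta> = (p - 1) * Y_inf p q m \<alpha> \<beta> + real N - p"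

definition X_inf :: "nat \<Rightarrow> real \<Rightarrow> real \<Rightarrow> real \<Rightarrow> real \<Rightarrow> real \<Rightarrow> real"
  where "X_inf N p q m \<alpha> \<beta> =
    1 / (p - 1) * Z_inf N p q m \<alpha> \<beta> + (p - real N) / (p - 1)"

definition A_lim :: "nat \<Rightarrow> real \<Rightarrow> real \<Rightarrow> real \<Rightarrow> real \<Rightarrow> real \<Rightarrow> real"
  where "A_lim N p q m \<alpha> \<beta> =
    (let \<delta> = system_delta p q m \<alpha> \<beta> in
     1 / (Y_inf p q m \<alpha> \<beta> powr (m * (p - 1) / \<delta>) *
          Z_inf N p q m \<alpha> \<beta> powr ((p - 1 - \<beta>) / \<delta>) *
          W_inf N p q m \<alpha> \<beta> powr (m / \<delta>) *
          X_inf N p q m \<alpha> \<beta>))"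

definition B_lim :: "nat \<Rightarrow> real \<Rightarrow> real \<Rightarrow> real \<Rightarrow> real \<Rightarrow> real \<Rightarrow> real"
  where "B_lim N p q m \<alpha> \<beta> =
    (let \<delta> = system_delta p q m \<alpha> \<beta> in
     1 / (Y_inf p q m \<alpha> \<beta> powr ((p - 1) * (p - 1 - \<alpha>) / \<delta>) *
          Z_inf N p q m \<alpha> \<beta> powr (q / \<delta>) *
          W_inf N p q m \<alpha> \<beta> powr ((p - 1 - \<alpha>) / \<delta>)))"

end

theory Submission
  imports Defs
begin

text \<open>Along a ray the system becomes \<open>(r\<^sup>N\<^sup>-\<^sup>1 u'\<^sup>p\<^sup>-\<^sup>1)' = r\<^sup>N\<^sup>-\<^sup>1 v\<^sup>m u'\<^sup>\<alpha>\<close> and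
  \<open>(r\<^sup>N\<^sup>-\<^sup>1 v'\<^sup>p\<^sup>-\<^sup>1)' = r\<^sup>N\<^sup>-\<^sup>1 v\<^sup>\<beta> u'\<^sup>q\<close>. Both right-hand sides are nonnegative, and the solution is not
  constant near the origin; hence \<open>u'\<close> and \<open>v'\<close> are positive for \<open>r > 0\<close>. So in \<open>t = ln r\<close> the
  quantities \<open>X = r u' / u\<close>, \<open>Y = r v' / v\<close>, \<open>Z = r v\<^sup>m u'\<^sup>\<alpha>\<^sup>-\<^sup>p\<^sup>+\<^sup>1\<close>, \<open>W = r v\<^sup>\<beta> u'\<^sup>q v'\<^sup>1\<^sup>-\<^sup>p\<close> are
  positive, and each of them solves a logistic equation \<open>y' = y (f - k y)\<close> with constant \<open>k > 0\<close>,
  in which \<open>f\<close> is a nondecreasing affine function of the other quantities: of \<open>W\<close> for \<open>Y\<close>, of \<open>Y\<close>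
  for \<open>Z\<close>, of \<open>Y\<close> and \<open>Z\<close> for \<open>W\<close>, and of \<open>Z\<close> for \<open>X\<close>.

  A logistic solution inherits positive upper and lower bounds, and positive limits, of \<open>f / k\<close>.
  Going once around the loop \<open>Y \<rightarrow> Z \<rightarrow> W \<rightarrow> Y\<close> replaces an asymptotic bound \<open>h\<close> of \<open>Y\<close> by \<open>\<Phi> h\<close>,
  up to an arbitrarily small loss, where \<open>\<Phi>\<close> is an affine map whose slope \<open>\<kappa>\<close> satisfies
  \<open>1 - \<kappa> = \<delta> / ((p - 1 - \<alpha>) (p - 1))\<close>. Thus \<open>\<delta> > 0\<close> makes \<open>\<Phi>\<close> a contraction, with fixed point \<open>Y_inf\<close>. The same contraction, applied to maxima over compact
  intervals, shows that \<open>Y\<close> is bounded (\<open>Y_bounded\<close>). Iterating \<open>\<Phi>\<close> from this bound and from the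
  lower bound \<open>0\<close> squeezes \<open>Y\<close> to \<open>Y_inf\<close> (\<open>Y_tendsto\<close>), and then \<open>Z\<close>, \<open>W\<close>, \<open>X\<close> converge too.

  Finally the logarithms of \<open>u\<close> and \<open>v\<close> are linear combinations of \<open>t\<close> and of the logarithms of
  \<open>X\<close>, \<open>Y\<close>, \<open>Z\<close>, \<open>W\<close> (\<open>lu_eq\<close>, \<open>lv_eq\<close>). The coefficients of \<open>t\<close> are the exponents of \<open>|x|\<close>
  in the theorem and the remaining terms converge to the logarithms of \<open>A\<close> and \<open>B\<close>.\<close>

section \<open>Logistic differential equations\<close>

text \<open>Multiplying \<open>s - k / F\<close> by the integrating factor \<open>exp (F t)\<close> makes it
  nondecreasing, so \<open>s\<close> is eventually at least \<open>k / F\<close> up to an exponentially small error.\<close>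
lemma linear_diff_ineq_eventually_greater:
  fixes s s' :: "real \<Rightarrow> real" and k F l :: real
  assumes der: "\<And>t. (s has_real_derivative s' t) (at t)"
    and ev: "\<forall>\<^sub>F t in at_top. s' t \<ge> k - F * s t"
    and "F > 0" and "l < k / F"
  shows "\<forall>\<^sub>F t in at_top. s t > l"
proof -
  obtain T where T: "\<And>t. t \<ge> T \<Longrightarrow> s' t \<ge> k - F * s t"
    using ev by (auto simp: eventually_at_top_linorder)
  have low: "s t \<ge> k / F + (s T - k / F) * exp (F * (T - t))" if "t \<ge> T" for t
  proof -
    have "(s T - k / F) * exp (F * T) \<le> (s t - k / F) * exp (F * t)"
    proof (rule DERIV_nonneg_imp_nondecreasing[OF that])
      fix x assume "T \<le> x" "x \<le> t"
      have "((\<lambda>t. (s t - k / F) * exp (F * t)) has_real_derivative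
          (s' x - (k - F * s x)) * exp (F * x)) (at x)"
        using \<open>F > 0\<close> by (auto intro!: derivative_eq_intros der simp: field_simps)
      moreover have "(s' x - (k - F * s x)) * exp (F * x) \<ge> 0"
        using T[OF \<open>T \<le> x\<close>] by simp
      ultimately show "\<exists>y. ((\<lambda>t. (s t - k / F) * exp (F * t)) has_real_derivative y) (at x) \<and> 0 \<le> y"
        by blast
    qed
    then have "(s T - k / F) * exp (F * T) * exp (- F * t)
        \<le> (s t - k / F) * exp (F * t) * exp (- F * t)"
      by (rule mult_right_mono) simp
    then show ?thesis
      by (simp add: mult.assoc exp_add[symmetric] algebra_simps)
  qed
  have "((\<lambda>t. k / F + (s T - k / F) * exp (F * (T - t))) \<longlongrightarrow> k / F + (s T - k / F) * 0) at_top"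
  proof (intro tendsto_intros)
    have "filterlim (\<lambda>t. F * (T - t)) at_bot at_top"
      unfolding filterlim_at_bot
    proof
      fix B show "\<forall>\<^sub>F t in at_top. F * (T - t) \<le> B"
        using \<open>F > 0\<close>
        by (intro eventually_at_top_linorderI[of "T - B / F"]) (simp add: field_simps)
    qed
    then show "((\<lambda>t. exp (F * (T - t))) \<longlongrightarrow> 0) at_top"
      by (rule filterlim_compose[OF exp_at_bot])
  qed
  then have "\<forall>\<^sub>F t in at_top. k / F + (s T - k / F) * exp (F * (T - t)) > l"
    using \<open>l < k / F\<close> by (intro order_tendstoD) auto
  with eventually_ge_at_top[of T] show ?thesis
    by eventually_elim (use low in fastforce)
qed

text \<open>A positive function with \<open>y' = y (f - k y)\<close> is driven by its coefficient \<open>f\<close>: it is pulled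
  towards \<open>f / k\<close>. The quantitative versions of this below (asymptotic one-sided bounds,
  a limit, and a bound on compact intervals) are all that is used about the four quantities
  \<open>X, Y, Z, W\<close> attached to a solution.\<close>
locale logistic =
  fixes y f :: "real \<Rightarrow> real" and k :: real
  assumes deriv: "\<And>t. (y has_real_derivative y t * (f t - k * y t)) (at t)"
    and pos: "\<And>t. y t > 0" and k_pos: "k > 0"
begin

text \<open>The reciprocal of a logistic solution solves a linear equation; this is what reduces both
  asymptotic bounds to the linear differential inequality.\<close>
lemma deriv_inverse: "((\<lambda>t. 1 / y t) has_real_derivative k - f t * (1 / y t)) (at t)"
  by (rule derivative_eq_intros refl deriv | use pos[of t] in \<open>simp add: field_simps power2_eq_square\<close>)+

lemma eventually_less:
  assumes "\<forall>\<^sub>F t in at_top. f t \<le> F" "F > 0" "F < k * y1"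
  shows "\<forall>\<^sub>F t in at_top. y t < y1"
proof -
  have "y1 > 0" using assms k_pos by (metis less_trans zero_less_mult_pos)
  have "\<forall>\<^sub>F t in at_top. k - f t * (1 / y t) \<ge> k - F * (1 / y t)"
    using assms(1) by eventually_elim (use pos in \<open>auto simp: divide_right_mono less_imp_le\<close>)
  then have "\<forall>\<^sub>F t in at_top. 1 / y t > 1 / y1"
    using \<open>F > 0\<close> \<open>F < k * y1\<close> \<open>y1 > 0\<close>
    by (intro linear_diff_ineq_eventually_greater[OF deriv_inverse, where k = k and F = F])
      (auto simp: field_simps)
  then show ?thesis
    by eventually_elim (use pos \<open>y1 > 0\<close> in \<open>auto simp: field_simps\<close>)
qed

lemma eventually_greater:
  assumes "\<forall>\<^sub>F t in at_top. f t \<ge> F" "F > 0" "k * y1 < F" "y1 > 0"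
  shows "\<forall>\<^sub>F t in at_top. y t > y1"
proof -
  have "\<forall>\<^sub>F t in at_top. - (k - f t * (1 / y t)) \<ge> - k - F * (- (1 / y t))"
    using assms(1) by eventually_elim (use pos in \<open>auto simp: divide_right_mono less_imp_le\<close>)
  then have "\<forall>\<^sub>F t in at_top. - (1 / y t) > - (1 / y1)"
    using assms
    by (intro linear_diff_ineq_eventually_greater
        [OF DERIV_minus[OF deriv_inverse], where k = "- k" and F = F]) (auto simp: field_simps)
  then show ?thesis
    by eventually_elim (use pos \<open>y1 > 0\<close> in \<open>auto simp: field_simps\<close>)
qed

lemma tendsto:
  assumes "(f \<longlongrightarrow> F) at_top" "F > 0"
  shows "(y \<longlongrightarrow> F / k) at_top"
proof (rule order_tendstoI)
  fix a assume "F / k < a"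
  then have "F < k * a" using k_pos by (simp add: field_simps)
  then obtain G where G: "F < G" "G < k * a" using dense by blast
  have "\<forall>\<^sub>F t in at_top. f t \<le> G"
    using order_tendstoD(2)[OF assms(1) G(1)] by eventually_elim simp
  then show "\<forall>\<^sub>F t in at_top. y t < a"
    by (rule eventually_less) (use G assms in auto)
next
  fix a assume "a < F / k"
  then have "k * a < F" using k_pos by (simp add: field_simps)
  then have "max 0 (k * a) < F" using assms by simp
  then obtain G where G: "max 0 (k * a) < G" "G < F" using dense by blast
  have ev: "\<forall>\<^sub>F t in at_top. f t \<ge> G"
    using order_tendstoD(1)[OF assms(1) G(2)] by eventually_elim simp
  show "\<forall>\<^sub>F t in at_top. y t > a"
  proof (cases "a > 0")
    case True
    show ?thesis by (rule eventually_greater[OF ev]) (use G True in auto)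
  next
    case False
    then show ?thesis using pos by (intro always_eventually allI) (metis not_less order_le_less_trans)
  qed
qed

text \<open>At a maximum point other than the left endpoint the derivative is nonnegative, so there
  \<open>k y \<le> f\<close>. The sum on the right replaces the maximum of the two alternatives, so that the
  bound is affine in \<open>F\<close> and can be chained.\<close>
lemma bounded_on_interval:
  assumes "\<And>t. 0 \<le> t \<Longrightarrow> t \<le> T \<Longrightarrow> f t \<le> F" "0 \<le> F" "0 \<le> t" "t \<le> T"
  shows "k * y t \<le> k * y 0 + F"
proof -
  have "continuous_on {0..T} y"
    by (meson DERIV_isCont continuous_at_imp_continuous_on deriv)
  then obtain s where s: "s \<in> {0..T}" "\<And>t. t \<in> {0..T} \<Longrightarrow> y t \<le> y s"
    using continuous_attains_sup[of "{0..T}" y] assms by auto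
  have "k * y s \<le> k * y 0 + F"
  proof (cases "s = 0")
    case True then show ?thesis using \<open>0 \<le> F\<close> by simp
  next
    case False
    have "\<not> f s < k * y s"
    proof
      assume "f s < k * y s"
      then have "y s * (f s - k * y s) < 0" using pos[of s] by (simp add: mult_pos_neg)
      then obtain d where d: "d > 0" "\<And>h. h > 0 \<Longrightarrow> h < d \<Longrightarrow> y s < y (s - h)"
        using DERIV_neg_dec_left[OF deriv] by blast
      define h where "h = min (d/2) s"
      have "h > 0" "h < d" "s - h \<in> {0..T}" using False s d by (auto simp: h_def)
      then show False using d(2)[of h] s(2)[of "s - h"] by simp
    qed
    moreover have "k * y 0 \<ge> 0" using pos[of 0] k_pos by (simp add: less_imp_le)
    ultimately show ?thesis using assms(1)[of s] s(1) by simp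
  qed
  moreover have "y t \<le> y s" using s assms by simp
  ultimately show ?thesis using k_pos by (smt (verit) mult_left_mono)
qed

end

lemma logistic_exp:
  assumes "\<And>t. (L has_real_derivative f t - k * exp (L t)) (at t)" "0 < k"
  shows "logistic (\<lambda>t. exp (L t)) f k"
proof
  show "((\<lambda>t. exp (L t)) has_real_derivative exp (L t) * (f t - k * exp (L t))) (at t)" for t
    by (rule DERIV_fun_exp[OF assms(1)])
qed (use assms in auto)

section \<open>Convergence of the scaling-invariant quantities\<close>

text \<open>Here \<open>t = ln r\<close>, and \<open>lu\<close>, \<open>lv\<close>, \<open>lP\<close>, \<open>lQ\<close> are the logarithms of \<open>u\<close>, \<open>v\<close> and of the fluxes
  \<open>P = u'(r)\<^sup>p\<^sup>-\<^sup>1\<close>, \<open>Q = v'(r)\<^sup>p\<^sup>-\<^sup>1\<close>, as functions of \<open>t\<close>. Working with logarithms turns every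
  algebraic relation between powers of these functions into a linear one.\<close>
locale logarithmic_radial_flow =
  fixes N :: nat and p q m \<alpha> \<beta> :: real and lu lv lP lQ :: "real \<Rightarrow> real"
  assumes N: "1 \<le> real N" and p: "1 < p" and m: "0 < m" and q: "0 < q"
    and \<alpha>: "0 \<le> \<alpha>" "\<alpha> < p - 1" and \<beta>: "0 \<le> \<beta>"
    and delta: "0 < system_delta p q m \<alpha> \<beta>"
    and lu: "\<And>t. (lu has_real_derivative exp (t + lP t / (p - 1) - lu t)) (at t)"
    and lv: "\<And>t. (lv has_real_derivative exp (t + lQ t / (p - 1) - lv t)) (at t)"
    and lP: "\<And>t. (lP has_real_derivative
      exp (t + m * lv t - (p - 1 - \<alpha>) / (p - 1) * lP t) - (real N - 1)) (at t)"
    and lQ: "\<And>t. (lQ has_real_derivative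
      exp (t + \<beta> * lv t + q / (p - 1) * lP t - lQ t) - (real N - 1)) (at t)"
begin

text \<open>In terms of \<open>u\<close>, \<open>v\<close> these are \<open>X = r u' / u\<close>, \<open>Y = r v' / v\<close>, \<open>Z = r v\<^sup>m u'\<^sup>\<alpha>\<^sup>-\<^sup>p\<^sup>+\<^sup>1\<close> and
  \<open>W = r v\<^sup>\<beta> u'\<^sup>q v'\<^sup>1\<^sup>-\<^sup>p\<close>; they are invariant under the scaling of the system, which is why they
  satisfy an autonomous system.\<close>
definition "X t = exp (t + lP t / (p - 1) - lu t)"
definition "Y t = exp (t + lQ t / (p - 1) - lv t)"
definition "Z t = exp (t + m * lv t - (p - 1 - \<alpha>) / (p - 1) * lP t)"
definition "W t = exp (t + \<beta> * lv t + q / (p - 1) * lP t - lQ t)"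

lemmas log_derivs = lu[folded X_def] lv[folded Y_def] lP[folded Z_def] lQ[folded W_def]

sublocale X: logistic X "\<lambda>t. 1 + (Z t - (real N - 1)) / (p - 1)" 1
  unfolding X_def[abs_def]
proof (rule logistic_exp)
  show "((\<lambda>t. t + lP t / (p - 1) - lu t) has_real_derivative
      1 + (Z t - (real N - 1)) / (p - 1) - 1 * exp (t + lP t / (p - 1) - lu t)) (at t)" for t
    unfolding X_def[symmetric] mult_1
    by (intro DERIV_add DERIV_diff DERIV_cdivide DERIV_ident log_derivs)
qed simp

sublocale Y: logistic Y "\<lambda>t. 1 + (W t - (real N - 1)) / (p - 1)" 1
  unfolding Y_def[abs_def]
proof (rule logistic_exp)
  show "((\<lambda>t. t + lQ t / (p - 1) - lv t) has_real_derivative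
      1 + (W t - (real N - 1)) / (p - 1) - 1 * exp (t + lQ t / (p - 1) - lv t)) (at t)" for t
    unfolding Y_def[symmetric] mult_1
    by (intro DERIV_add DERIV_diff DERIV_cdivide DERIV_ident log_derivs)
qed simp

sublocale Z: logistic Z "\<lambda>t. 1 + m * Y t + (p - 1 - \<alpha>) / (p - 1) * (real N - 1)"
  "(p - 1 - \<alpha>) / (p - 1)"
  unfolding Z_def[abs_def]
proof (rule logistic_exp)
  have "((\<lambda>t. t + m * lv t - (p - 1 - \<alpha>) / (p - 1) * lP t) has_real_derivative
      1 + m * Y t - (p - 1 - \<alpha>) / (p - 1) * (Z t - (real N - 1))) (at t)" for t
    by (intro DERIV_add DERIV_diff DERIV_cmult DERIV_ident log_derivs)
  then show "((\<lambda>t. t + m * lv t - (p - 1 - \<alpha>) / (p - 1) * lP t) has_real_derivative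
      1 + m * Y t + (p - 1 - \<alpha>) / (p - 1) * (real N - 1)
      - (p - 1 - \<alpha>) / (p - 1) * exp (t + m * lv t - (p - 1 - \<alpha>) / (p - 1) * lP t)) (at t)" for t
    unfolding Z_def[symmetric] right_diff_distrib by (simp add: algebra_simps)
qed (use p \<alpha> in simp)

sublocale W: logistic W "\<lambda>t. real N + \<beta> * Y t + q / (p - 1) * (Z t - (real N - 1))" 1
  unfolding W_def[abs_def]
proof (rule logistic_exp)
  have "((\<lambda>t. t + \<beta> * lv t + q / (p - 1) * lP t - lQ t) has_real_derivative
      1 + \<beta> * Y t + q / (p - 1) * (Z t - (real N - 1)) - (W t - (real N - 1))) (at t)" for t
    by (intro DERIV_add DERIV_diff DERIV_cmult DERIV_ident log_derivs)
  then show "((\<lambda>t. t + \<beta> * lv t + q / (p - 1) * lP t - lQ t) has_real_derivative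
      real N + \<beta> * Y t + q / (p - 1) * (Z t - (real N - 1))
      - 1 * exp (t + \<beta> * lv t + q / (p - 1) * lP t - lQ t)) (at t)" for t
    unfolding W_def[symmetric] by (simp add: algebra_simps)
qed simp

text \<open>If \<open>Y\<close> stayed at the constant value \<open>h\<close>, then \<open>Z\<close>, next \<open>W\<close>, and then \<open>Y\<close> would be pulled
  towards the equilibria of their logistic equations, and \<open>\<Phi> h\<close> is the resulting value for \<open>Y\<close>.
  All couplings are nondecreasing, so the same map transports upper bounds and lower bounds.
  It is affine with slope \<open>\<kappa>\<close>.\<close>
definition "\<kappa> = (\<beta> + q * m / (p - 1 - \<alpha>)) / (p - 1)"
definition "\<Phi> h = (p + q / (p - 1 - \<alpha>)) / (p - 1) + \<kappa> * h"

text \<open>The condition \<open>\<delta> > 0\<close> says exactly that the loop \<open>Y \<rightarrow> Z \<rightarrow> W \<rightarrow> Y\<close> has gain \<open>\<kappa> < 1\<close>.\<close>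
lemma one_minus_\<kappa>:
  "1 - \<kappa> = system_delta p q m \<alpha> \<beta> / ((p - 1 - \<alpha>) * (p - 1))"
proof -
  have "1 - (\<beta> + q * m / s) / a = (s * (a - \<beta>) - q * m) / (s * a)"
    if "s > 0" "a > 0" for s a :: real
    using that by (simp add: field_simps)
  then show ?thesis
    unfolding \<kappa>_def system_delta_def using p \<alpha> by simp
qed

lemma \<kappa>: "0 < \<kappa>" "\<kappa> < 1"
proof -
  show "0 < \<kappa>"
    unfolding \<kappa>_def using p m q \<alpha> \<beta> by (intro divide_pos_pos add_nonneg_pos) auto
  have "0 < 1 - \<kappa>"
    unfolding one_minus_\<kappa> using p \<alpha> delta by simp
  then show "\<kappa> < 1" by simp
qed

lemma \<Phi>_times: "(p - 1) * \<Phi> h = p + \<beta> * h + q / (p - 1 - \<alpha>) * (1 + m * h)"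
  using p by (simp add: \<Phi>_def \<kappa>_def distrib_left add_divide_distrib distrib_right)

abbreviation "Y\<^sub>e \<equiv> Y_inf p q m \<alpha> \<beta>"

lemma Y\<^sub>e_pos: "0 < Y\<^sub>e"
  unfolding Y_inf_def using p q \<alpha> delta by (intro divide_pos_pos add_pos_pos mult_pos_pos) auto

lemma \<Phi>_contracts: "\<Phi> (Y\<^sub>e + a) = Y\<^sub>e + \<kappa> * a"
proof -
  have "(1 - \<kappa>) * Y\<^sub>e = (p * (p - 1 - \<alpha>) + q) / ((p - 1 - \<alpha>) * (p - 1))"
    using delta by (simp add: one_minus_\<kappa> Y_inf_def)
  also have "\<dots> = (p + q / (p - 1 - \<alpha>)) / (p - 1)"
    using p \<alpha> by (simp add: field_simps)
  finally have "(1 - \<kappa>) * Y\<^sub>e = (p + q / (p - 1 - \<alpha>)) / (p - 1)" .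
  then show ?thesis
    by (simp add: \<Phi>_def algebra_simps)
qed

text \<open>An eventual upper bound for \<open>Y\<close> passes to \<open>Z\<close>, then to \<open>W\<close>, then back to \<open>Y\<close>. Each passage
  loses an arbitrarily small amount.\<close>
lemma eventually_below_\<Phi>:
  assumes "\<forall>\<^sub>F t in at_top. Y t \<le> h" "0 \<le> h" "\<Phi> h < h1"
  shows "\<forall>\<^sub>F t in at_top. Y t \<le> h1"
proof -
  define \<sigma> where "\<sigma> = p - 1 - \<alpha>"
  have \<sigma>: "\<sigma> > 0" using \<alpha> by (simp add: \<sigma>_def)
  \<comment> \<open>The bounds are chosen backwards: \<open>w\<close> for \<open>W\<close> is good enough to give \<open>h1\<close> for \<open>Y\<close>,
    and \<open>z\<close> for \<open>Z\<close> is good enough to give \<open>w\<close>.\<close>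
  have "real N + \<beta> * h + q / \<sigma> * (1 + m * h) < (p - 1) * (h1 - 1) + (real N - 1)"
    using mult_strict_left_mono[OF \<open>\<Phi> h < h1\<close>, of "p - 1"] p
    unfolding \<Phi>_times \<sigma>_def[symmetric] by (simp add: right_diff_distrib)
  then obtain w where w: "real N + \<beta> * h + q / \<sigma> * (1 + m * h) < w" "w < (p - 1) * (h1 - 1) + (real N - 1)"
    using dense by blast
  have "real N - 1 + (p - 1) / \<sigma> * (1 + m * h) < real N - 1 + (p - 1) / q * (w - real N - \<beta> * h)"
    using mult_strict_left_mono[of "q / \<sigma> * (1 + m * h)" "w - real N - \<beta> * h" "(p - 1) / q"] w(1) p q
    by simp
  then obtain z where z: "real N - 1 + (p - 1) / \<sigma> * (1 + m * h) < z"
    "z < real N - 1 + (p - 1) / q * (w - real N - \<beta> * h)"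
    using dense by blast
  have pos: "0 \<le> m * h" "0 \<le> \<sigma> / (p - 1) * (real N - 1)" "0 \<le> \<beta> * h"
    "0 \<le> (p - 1) / \<sigma> * (1 + m * h)" "0 \<le> q / \<sigma> * (1 + m * h)"
    using m assms(2) \<sigma> p N \<beta> q by auto
  have fZ: "\<forall>\<^sub>F t in at_top. 1 + m * Y t + (p - 1 - \<alpha>) / (p - 1) * (real N - 1)
      \<le> 1 + m * h + (p - 1 - \<alpha>) / (p - 1) * (real N - 1)"
    using assms(1) by eventually_elim (use m in simp)
  have "\<forall>\<^sub>F t in at_top. Z t < z"
  proof (rule Z.eventually_less[OF fZ])
    show "0 < 1 + m * h + (p - 1 - \<alpha>) / (p - 1) * (real N - 1)"
      using pos by (simp add: \<sigma>_def)
    have "\<sigma> / (p - 1) * (real N - 1 + (p - 1) / \<sigma> * (1 + m * h)) < \<sigma> / (p - 1) * z"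
      using z(1) \<sigma> p by (intro mult_strict_left_mono) auto
    then show "1 + m * h + (p - 1 - \<alpha>) / (p - 1) * (real N - 1) < (p - 1 - \<alpha>) / (p - 1) * z"
      using \<sigma> p unfolding \<sigma>_def[symmetric] by (simp add: distrib_left)
  qed
  with assms(1) have fW: "\<forall>\<^sub>F t in at_top.
      real N + \<beta> * Y t + q / (p - 1) * (Z t - (real N - 1)) \<le> real N + \<beta> * h + q / (p - 1) * (z - (real N - 1))"
    by eventually_elim (use \<beta> p q in \<open>auto intro!: add_mono mult_left_mono divide_right_mono\<close>)
  have "\<forall>\<^sub>F t in at_top. W t < w"
  proof (rule W.eventually_less[OF fW])
    have "0 \<le> q / (p - 1) * (z - (real N - 1))"
      using z(1) pos p q by (intro mult_nonneg_nonneg) auto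
    then show "0 < real N + \<beta> * h + q / (p - 1) * (z - (real N - 1))" using pos N by simp
    show "real N + \<beta> * h + q / (p - 1) * (z - (real N - 1)) < 1 * w"
      using z(2) p q by (simp add: field_simps)
  qed
  then have fY: "\<forall>\<^sub>F t in at_top. 1 + (W t - (real N - 1)) / (p - 1) \<le> 1 + (w - (real N - 1)) / (p - 1)"
    by eventually_elim (use p in \<open>auto simp: divide_right_mono\<close>)
  have "\<forall>\<^sub>F t in at_top. Y t < h1"
  proof (rule Y.eventually_less[OF fY])
    show "0 < 1 + (w - (real N - 1)) / (p - 1)"
      using w(1) pos p N by (intro add_pos_nonneg divide_nonneg_pos) auto
    show "1 + (w - (real N - 1)) / (p - 1) < 1 * h1"
      using w(2) p by (simp add: field_simps)
  qed
  then show ?thesis by eventually_elim simp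
qed

text \<open>The mirror image. Lower bounds of logistic solutions come from positive numbers only. Since
  \<open>\<Phi> h > 1\<close>, the target may be raised above \<open>1\<close>, and then \<open>z\<close> and \<open>w\<close> can be taken above \<open>N - 1\<close>.\<close>
lemma eventually_above_\<Phi>:
  assumes "\<forall>\<^sub>F t in at_top. h \<le> Y t" "0 \<le> h" "h1 < \<Phi> h"
  shows "\<forall>\<^sub>F t in at_top. h1 \<le> Y t"
proof -
  define \<sigma> where "\<sigma> = p - 1 - \<alpha>"
  have \<sigma>: "\<sigma> > 0" using \<alpha> by (simp add: \<sigma>_def)
  have pos: "0 \<le> m * h" "0 \<le> \<sigma> / (p - 1) * (real N - 1)" "0 \<le> \<beta> * h"
    using m assms(2) \<sigma> p N \<beta> by auto
  have "1 < (p + q / \<sigma>) / (p - 1)"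
    using p q \<sigma> by (simp add: field_simps add_pos_pos)
  moreover have "0 \<le> \<kappa> * h" using \<kappa> \<open>0 \<le> h\<close> by simp
  ultimately have "max 1 h1 < \<Phi> h"
    using \<open>h1 < \<Phi> h\<close> by (simp add: \<Phi>_def \<sigma>_def)
  then obtain h2 where h2: "1 < h2" "h1 < h2" "h2 < \<Phi> h"
    using dense[of "max 1 h1" "\<Phi> h"] by auto
  have "(p - 1) * (h2 - 1) + (real N - 1) < real N + \<beta> * h + q / \<sigma> * (1 + m * h)"
    using mult_strict_left_mono[OF \<open>h2 < \<Phi> h\<close>, of "p - 1"] p
    unfolding \<Phi>_times \<sigma>_def[symmetric] by (simp add: right_diff_distrib)
  then obtain w where w: "w < real N + \<beta> * h + q / \<sigma> * (1 + m * h)" "(p - 1) * (h2 - 1) + (real N - 1) < w"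
    using dense by blast
  have "real N - 1 < w" using w(2) h2(1) p by (smt (verit) mult_pos_pos)
  have "real N - 1 + (p - 1) / q * (w - real N - \<beta> * h) < real N - 1 + (p - 1) / \<sigma> * (1 + m * h)"
    using mult_strict_left_mono[of "w - real N - \<beta> * h" "q / \<sigma> * (1 + m * h)" "(p - 1) / q"] w(1) p q
    by simp
  moreover have "0 < (p - 1) / \<sigma> * (1 + m * h)"
    using p \<sigma> pos by (intro mult_pos_pos divide_pos_pos) auto
  ultimately obtain z where z: "z < real N - 1 + (p - 1) / \<sigma> * (1 + m * h)"
    "real N - 1 + (p - 1) / q * (w - real N - \<beta> * h) < z" "real N - 1 < z"
    using dense[of "max (real N - 1 + (p - 1) / q * (w - real N - \<beta> * h)) (real N - 1)"
        "real N - 1 + (p - 1) / \<sigma> * (1 + m * h)"] by auto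
  have fZ: "\<forall>\<^sub>F t in at_top. 1 + m * h + (p - 1 - \<alpha>) / (p - 1) * (real N - 1)
      \<le> 1 + m * Y t + (p - 1 - \<alpha>) / (p - 1) * (real N - 1)"
    using assms(1) by eventually_elim (use m in simp)
  have "\<forall>\<^sub>F t in at_top. z < Z t"
  proof (rule Z.eventually_greater[OF fZ])
    show "0 < 1 + m * h + (p - 1 - \<alpha>) / (p - 1) * (real N - 1)"
      using pos by (simp add: \<sigma>_def)
    have "\<sigma> / (p - 1) * z < \<sigma> / (p - 1) * (real N - 1 + (p - 1) / \<sigma> * (1 + m * h))"
      using z(1) \<sigma> p by (intro mult_strict_left_mono) auto
    then show "(p - 1 - \<alpha>) / (p - 1) * z < 1 + m * h + (p - 1 - \<alpha>) / (p - 1) * (real N - 1)"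
      using \<sigma> p unfolding \<sigma>_def[symmetric] by (simp add: distrib_left)
    show "0 < z" using z(3) N by simp
  qed
  with assms(1) have fW: "\<forall>\<^sub>F t in at_top.
      real N + \<beta> * h + q / (p - 1) * (z - (real N - 1)) \<le> real N + \<beta> * Y t + q / (p - 1) * (Z t - (real N - 1))"
    by eventually_elim (use \<beta> p q in \<open>auto intro!: add_mono mult_left_mono divide_right_mono\<close>)
  have "\<forall>\<^sub>F t in at_top. w < W t"
  proof (rule W.eventually_greater[OF fW])
    have "0 \<le> q / (p - 1) * (z - (real N - 1))"
      using z(3) p q by (intro mult_nonneg_nonneg) auto
    then show "0 < real N + \<beta> * h + q / (p - 1) * (z - (real N - 1))" using pos N by simp
    show "1 * w < real N + \<beta> * h + q / (p - 1) * (z - (real N - 1))"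
      using z(2) p q by (simp add: field_simps)
    show "0 < w" using \<open>real N - 1 < w\<close> N by simp
  qed
  then have fY: "\<forall>\<^sub>F t in at_top. 1 + (w - (real N - 1)) / (p - 1) \<le> 1 + (W t - (real N - 1)) / (p - 1)"
    by eventually_elim (use p in \<open>auto simp: divide_right_mono\<close>)
  have "\<forall>\<^sub>F t in at_top. h2 < Y t"
  proof (rule Y.eventually_greater[OF fY])
    show "0 < 1 + (w - (real N - 1)) / (p - 1)"
      using \<open>real N - 1 < w\<close> p by (intro add_pos_nonneg divide_nonneg_pos) auto
    show "1 * h2 < 1 + (w - (real N - 1)) / (p - 1)"
      using w(2) p by (simp add: field_simps)
    show "0 < h2" using h2 by simp
  qed
  then show ?thesis by eventually_elim (use h2 in simp)
qed

text \<open>On \<open>[0, T]\<close> the maximum \<open>M\<close> of \<open>Y\<close> bounds \<open>Z\<close>, then \<open>W\<close>, and finally \<open>M\<close> itself, by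
  \<open>M \<le> K + \<kappa> M\<close> with \<open>K\<close> depending only on the values at \<open>0\<close>. As \<open>\<kappa> < 1\<close> this bounds \<open>M\<close>
  uniformly in \<open>T\<close>.\<close>
lemma Y_bounded: "\<exists>C. \<forall>t\<ge>0. Y t \<le> C"
proof -
  define \<sigma> where "\<sigma> = p - 1 - \<alpha>"
  have \<sigma>: "\<sigma> > 0" using \<alpha> by (simp add: \<sigma>_def)
  define K where "K = Y 0 + 1 + (W 0 + 1 + q / (p - 1) * Z 0 + q / \<sigma>) / (p - 1)"
  have "Y T \<le> K / (1 - \<kappa>)" if "T \<ge> 0" for T
  proof -
    have "continuous_on {0..T} Y"
      by (meson DERIV_isCont continuous_at_imp_continuous_on Y.deriv)
    moreover have "{0..T} \<noteq> {}" using that by simp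
    ultimately obtain s where s: "s \<in> {0..T}" "\<And>t. t \<in> {0..T} \<Longrightarrow> Y t \<le> Y s"
      using continuous_attains_sup[OF compact_Icc] by blast
    define M where "M = Y s"
    have M: "0 \<le> M" and YM: "\<And>t. 0 \<le> t \<Longrightarrow> t \<le> T \<Longrightarrow> Y t \<le> M"
      using Y.pos[of s] s(2) by (auto simp: M_def)
    define z where "z = Z 0 + (real N - 1) + (p - 1) / \<sigma> * (1 + m * M)"
    have z0: "real N - 1 \<le> z"
      using Z.pos[of 0] M m \<sigma> p by (auto simp: z_def)
    have Zz: "Z t \<le> z" if t: "0 \<le> t" "t \<le> T" for t
    proof -
      have "\<sigma> / (p - 1) * Z t \<le> \<sigma> / (p - 1) * Z 0 + (1 + m * M + \<sigma> / (p - 1) * (real N - 1))"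
        unfolding \<sigma>_def
      proof (rule Z.bounded_on_interval[OF _ _ t])
        show "1 + m * Y t + (p - 1 - \<alpha>) / (p - 1) * (real N - 1)
            \<le> 1 + m * M + (p - 1 - \<alpha>) / (p - 1) * (real N - 1)" if "0 \<le> t" "t \<le> T" for t
          using YM[OF that] m by simp
        show "0 \<le> 1 + m * M + (p - 1 - \<alpha>) / (p - 1) * (real N - 1)"
          using M m N p \<alpha> by simp
      qed
      also have "\<dots> = \<sigma> / (p - 1) * z"
        using \<sigma> p by (simp add: z_def distrib_left)
      finally have "\<sigma> / (p - 1) * Z t \<le> \<sigma> / (p - 1) * z" .
      moreover have "0 < \<sigma> / (p - 1)" using \<sigma> p by simp
      ultimately show ?thesis by (simp only: mult_le_cancel_left_pos)
    qed
    define w where "w = W 0 + (real N + \<beta> * M + q / (p - 1) * (z - (real N - 1)))"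
    have pos: "0 \<le> \<beta> * M" "0 \<le> q / (p - 1) * (z - (real N - 1))"
      using \<beta> M q p z0 by auto
    have Ww: "W t \<le> w" if t: "0 \<le> t" "t \<le> T" for t
    proof -
      have "1 * W t \<le> 1 * W 0 + (real N + \<beta> * M + q / (p - 1) * (z - (real N - 1)))"
      proof (rule W.bounded_on_interval[OF _ _ t])
        show "real N + \<beta> * Y t + q / (p - 1) * (Z t - (real N - 1))
            \<le> real N + \<beta> * M + q / (p - 1) * (z - (real N - 1))" if "0 \<le> t" "t \<le> T" for t
          using YM[OF that] Zz[OF that] \<beta> p q
          by (auto intro!: add_mono mult_left_mono divide_right_mono)
        show "0 \<le> real N + \<beta> * M + q / (p - 1) * (z - (real N - 1))"
          using pos N by linarith
      qed
      then show ?thesis by (simp add: w_def)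
    qed
    have "1 * Y s \<le> 1 * Y 0 + (1 + (w - (real N - 1)) / (p - 1))"
    proof (rule Y.bounded_on_interval)
      show "1 + (W t - (real N - 1)) / (p - 1) \<le> 1 + (w - (real N - 1)) / (p - 1)"
        if "0 \<le> t" "t \<le> T" for t
        using Ww[OF that] p by (simp add: divide_right_mono)
      have "0 \<le> w - (real N - 1)"
        using pos W.pos[of 0] by (simp add: w_def)
      then show "0 \<le> 1 + (w - (real N - 1)) / (p - 1)"
        using p by (intro add_nonneg_nonneg divide_nonneg_pos) auto
    qed (use s(1) in auto)
    also have "1 * Y 0 + (1 + (w - (real N - 1)) / (p - 1)) = K + \<kappa> * M"
    proof -
      have "q / (p - 1) * (z - (real N - 1)) = q / (p - 1) * Z 0 + q / \<sigma> * (1 + m * M)"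
        using p by (simp add: z_def distrib_left)
      then have "w - (real N - 1) = (W 0 + 1 + q / (p - 1) * Z 0 + q / \<sigma>) + (\<beta> + q * m / \<sigma>) * M"
        by (simp add: w_def algebra_simps)
      moreover have "(b + c * M) / d = b / d + c / d * M" for b c d :: real
        by (simp add: add_divide_distrib)
      ultimately have "(w - (real N - 1)) / (p - 1)
          = (W 0 + 1 + q / (p - 1) * Z 0 + q / \<sigma>) / (p - 1) + \<kappa> * M"
        by (simp only: \<kappa>_def \<sigma>_def)
      then show ?thesis by (simp only: K_def)
    qed
    finally have "(1 - \<kappa>) * M \<le> K" by (simp add: M_def algebra_simps)
    then have "M \<le> K / (1 - \<kappa>)" using \<kappa> by (simp add: field_simps)
    then show ?thesis using YM[of T] that by simp
  qed
  then show ?thesis by blast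
qed

text \<open>Starting from a bound for \<open>Y\<close> above and from \<open>0\<close> below, each use of \<open>\<Phi>\<close> shrinks the distance of
  the bounds from the fixed point by the factor \<open>\<kappa>\<close>; the slightly larger factor \<open>\<rho>\<close> absorbs the
  arbitrarily small losses.\<close>
lemma Y_tendsto: "(Y \<longlongrightarrow> Y\<^sub>e) at_top"
proof -
  obtain C where C: "\<And>t. t \<ge> 0 \<Longrightarrow> Y t \<le> C" using Y_bounded by blast
  define a where "a = max 1 (C - Y\<^sub>e)"
  define \<rho> where "\<rho> = (\<kappa> + 1) / 2"
  have \<rho>: "\<kappa> < \<rho>" "0 < \<rho>" "\<rho> < 1" using \<kappa> by (auto simp: \<rho>_def)
  have upper: "\<forall>\<^sub>F t in at_top. Y t \<le> Y\<^sub>e + \<rho> ^ j * a" for j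
  proof (induction j)
    case 0
    show ?case
      using eventually_ge_at_top[of 0] by eventually_elim (use C in \<open>force simp: a_def\<close>)
  next
    case (Suc j)
    have "\<kappa> * (\<rho> ^ j * a) < \<rho> * (\<rho> ^ j * a)"
      using \<rho> by (intro mult_strict_right_mono) (auto simp: a_def)
    then have "\<Phi> (Y\<^sub>e + \<rho> ^ j * a) < Y\<^sub>e + \<rho> ^ Suc j * a"
      by (simp add: \<Phi>_contracts mult.assoc)
    moreover have "0 \<le> Y\<^sub>e + \<rho> ^ j * a"
      using Y\<^sub>e_pos \<rho> by (intro add_nonneg_nonneg mult_nonneg_nonneg) (auto simp: a_def)
    ultimately show ?case using eventually_below_\<Phi>[OF Suc] by blast
  qed
  have lower: "\<forall>\<^sub>F t in at_top. Y\<^sub>e - \<rho> ^ j * Y\<^sub>e \<le> Y t" for j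
  proof (induction j)
    case 0
    show ?case using Y.pos by (intro always_eventually) (simp add: less_imp_le)
  next
    case (Suc j)
    have "\<kappa> * (\<rho> ^ j * Y\<^sub>e) < \<rho> * (\<rho> ^ j * Y\<^sub>e)"
      using \<rho> Y\<^sub>e_pos by (intro mult_strict_right_mono) auto
    then have "Y\<^sub>e - \<rho> ^ Suc j * Y\<^sub>e < \<Phi> (Y\<^sub>e - \<rho> ^ j * Y\<^sub>e)"
      using \<Phi>_contracts[of "- (\<rho> ^ j * Y\<^sub>e)"] by (simp add: mult.assoc)
    moreover have "0 \<le> Y\<^sub>e - \<rho> ^ j * Y\<^sub>e"
      using Y\<^sub>e_pos \<rho> power_le_one[of \<rho> j] by (simp add: mult_left_le_one_le)
    ultimately show ?case using eventually_above_\<Phi>[OF Suc] by blast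
  qed
  have lim: "(\<lambda>j. \<rho> ^ j) \<longlonglongrightarrow> 0" using \<rho> by (intro LIMSEQ_power_zero) auto
  show ?thesis
  proof (rule order_tendstoI)
    fix y assume "Y\<^sub>e < y"
    moreover have "(\<lambda>j. Y\<^sub>e + \<rho> ^ j * a) \<longlonglongrightarrow> Y\<^sub>e + 0 * a" by (intro tendsto_intros lim)
    ultimately have "\<forall>\<^sub>F j in sequentially. Y\<^sub>e + \<rho> ^ j * a < y"
      by (intro order_tendstoD) auto
    then obtain j where "Y\<^sub>e + \<rho> ^ j * a < y" by (meson eventually_happens sequentially_bot)
    then show "\<forall>\<^sub>F t in at_top. Y t < y"
      using upper[of j] by (auto elim: eventually_mono)
  next
    fix y assume "y < Y\<^sub>e"
    moreover have "(\<lambda>j. Y\<^sub>e - \<rho> ^ j * Y\<^sub>e) \<longlonglongrightarrow> Y\<^sub>e - 0 * Y\<^sub>e" by (intro tendsto_intros lim)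
    ultimately have "\<forall>\<^sub>F j in sequentially. y < Y\<^sub>e - \<rho> ^ j * Y\<^sub>e"
      by (intro order_tendstoD) auto
    then obtain j where "y < Y\<^sub>e - \<rho> ^ j * Y\<^sub>e" by (meson eventually_happens sequentially_bot)
    then show "\<forall>\<^sub>F t in at_top. y < Y t"
      using lower[of j] by (auto elim: eventually_mono)
  qed
qed

lemma Z_tendsto: "(Z \<longlongrightarrow> Z_inf N p q m \<alpha> \<beta>) at_top"
proof -
  have "(Z \<longlongrightarrow> (1 + m * Y\<^sub>e + (p - 1 - \<alpha>) / (p - 1) * (real N - 1)) / ((p - 1 - \<alpha>) / (p - 1))) at_top"
  proof (rule Z.tendsto)
    show "0 < 1 + m * Y\<^sub>e + (p - 1 - \<alpha>) / (p - 1) * (real N - 1)"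
      using m Y\<^sub>e_pos p \<alpha> N by (intro add_pos_nonneg) auto
  qed (intro tendsto_intros Y_tendsto)
  also have "(1 + m * Y\<^sub>e + (p - 1 - \<alpha>) / (p - 1) * (real N - 1)) / ((p - 1 - \<alpha>) / (p - 1))
      = Z_inf N p q m \<alpha> \<beta>"
  proof -
    have "(1 + m * y + s / a * (real N - 1)) / (s / a) = m * a / s * y + real N + (a - s) / s"
      if "s > 0" "a > 0" for s a y :: real
      using that by (simp add: field_simps)
    from this[of "p - 1 - \<alpha>" "p - 1" "Y\<^sub>e"] show ?thesis
      unfolding Z_inf_def using p \<alpha> by simp
  qed
  finally show ?thesis .
qed

lemma Z_inf_gt: "real N - 1 < Z_inf N p q m \<alpha> \<beta>"
proof -
  have "0 < m * (p - 1) / (p - 1 - \<alpha>) * Y\<^sub>e" "0 \<le> \<alpha> / (p - 1 - \<alpha>)"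
    using m p \<alpha> Y\<^sub>e_pos by auto
  then show ?thesis by (simp add: Z_inf_def)
qed

text \<open>The number \<open>W_inf\<close> is defined through the equation for \<open>Y\<close>, whereas \<open>W\<close> tends to the
  equilibrium of its own equation. They agree because \<open>Y\<^sub>e\<close> is the fixed point of \<open>\<Phi>\<close>.\<close>
lemma W_inf_eq:
  "real N + \<beta> * Y\<^sub>e + q / (p - 1) * (Z_inf N p q m \<alpha> \<beta> - (real N - 1)) = W_inf N p q m \<alpha> \<beta>"
proof -
  have "q / a * (m * a / s * y + real N + (a - s) / s - (real N - 1)) = q / s * (1 + m * y)"
    if "s > 0" "a > 0" for s a y :: real
    using that by (simp add: field_simps)
  from this[of "p - 1 - \<alpha>" "p - 1" "Y\<^sub>e"]
  have "q / (p - 1) * (Z_inf N p q m \<alpha> \<beta> - (real N - 1)) = q / (p - 1 - \<alpha>) * (1 + m * Y\<^sub>e)"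
    unfolding Z_inf_def using p \<alpha> by simp
  moreover have "(p - 1) * Y\<^sub>e = p + \<beta> * Y\<^sub>e + q / (p - 1 - \<alpha>) * (1 + m * Y\<^sub>e)"
    using \<Phi>_times[of "Y\<^sub>e"] \<Phi>_contracts[of 0] by simp
  ultimately show ?thesis by (simp add: W_inf_def)
qed

lemma W_inf_pos: "0 < W_inf N p q m \<alpha> \<beta>"
  unfolding W_inf_eq[symmetric]
  using N \<beta> Y\<^sub>e_pos q p Z_inf_gt by (intro add_pos_nonneg mult_nonneg_nonneg) auto

lemma W_tendsto: "(W \<longlongrightarrow> W_inf N p q m \<alpha> \<beta>) at_top"
proof -
  have "(W \<longlongrightarrow> (real N + \<beta> * Y\<^sub>e + q / (p - 1) * (Z_inf N p q m \<alpha> \<beta> - (real N - 1))) / 1) at_top"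
    by (rule W.tendsto) (intro tendsto_intros Y_tendsto Z_tendsto, unfold W_inf_eq, rule W_inf_pos)
  then show ?thesis unfolding W_inf_eq by simp
qed

lemma X_inf_eq: "1 + (Z_inf N p q m \<alpha> \<beta> - (real N - 1)) / (p - 1) = X_inf N p q m \<alpha> \<beta>"
proof -
  have "1 + (z - (n - 1)) / a = 1 / a * z + (a + 1 - n) / a" if "a > 0" for a z n :: real
    using that by (simp add: field_simps)
  from this[of "p - 1" "Z_inf N p q m \<alpha> \<beta>" "real N"] show ?thesis
    using p by (simp add: X_inf_def)
qed

lemma X_inf_pos: "0 < X_inf N p q m \<alpha> \<beta>"
  unfolding X_inf_eq[symmetric] using Z_inf_gt p by (intro add_pos_pos) auto

lemma X_tendsto: "(X \<longlongrightarrow> X_inf N p q m \<alpha> \<beta>) at_top"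
proof -
  have "(X \<longlongrightarrow> (1 + (Z_inf N p q m \<alpha> \<beta> - (real N - 1)) / (p - 1)) / 1) at_top"
    by (rule X.tendsto) (intro tendsto_intros Z_tendsto, use p X_inf_pos in \<open>simp_all add: X_inf_eq\<close>)
  then show ?thesis by (simp add: X_inf_eq)
qed

lemma Z_inf_pos: "0 < Z_inf N p q m \<alpha> \<beta>"
  using Z_inf_gt N by simp

lemma A_lim_pos: "0 < A_lim N p q m \<alpha> \<beta>" and B_lim_pos: "0 < B_lim N p q m \<alpha> \<beta>"
  using Y\<^sub>e_pos Z_inf_pos W_inf_pos X_inf_pos
  by (simp_all add: A_lim_def B_lim_def Let_def)

text \<open>The definitions of \<open>ln Y\<close>, \<open>ln Z\<close>, \<open>ln W\<close> are three linear equations for \<open>lv\<close>, \<open>lP\<close>, \<open>lQ\<close>, with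
  determinant \<open>- \<delta> / (p - 1)\<^sup>2\<close>. Solving them shows that \<open>lv\<close> is the expected multiple
  of \<open>t\<close> up to terms that converge.\<close>
lemma lv_eq:
  "lv t = (p * (p - 1 - \<alpha>) + q) / system_delta p q m \<alpha> \<beta> * t
    - (p - 1) * (p - 1 - \<alpha>) / system_delta p q m \<alpha> \<beta> * ln (Y t)
    - q / system_delta p q m \<alpha> \<beta> * ln (Z t)
    - (p - 1 - \<alpha>) / system_delta p q m \<alpha> \<beta> * ln (W t)"
proof -
  have "d * lv t = (p * s + q) * t - a * s * ln (Y t) - q * ln (Z t) - s * ln (W t)"
    if "a = p - 1" "s = p - 1 - \<alpha>" "d = s * (a - \<beta>) - q * m" "a > 0" for a s d
  proof -
    have Y: "a * ln (Y t) = a * t + lQ t - a * lv t"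
      and Z: "ln (Z t) = t + m * lv t - s / a * lP t"
      and W: "ln (W t) = t + \<beta> * lv t + q / a * lP t - lQ t"
      using that by (simp_all add: Y_def Z_def W_def distrib_left right_diff_distrib)
    have "a * s * ln (Y t) = s * (a * t + lQ t - a * lv t)"
      using Y by (simp add: mult.commute mult.left_commute)
    moreover have "p = a + 1" using that by simp
    ultimately show ?thesis
      unfolding Z W that(3) by (simp add: algebra_simps)
  qed
  from this[of "p - 1" "p - 1 - \<alpha>" "system_delta p q m \<alpha> \<beta>"]
  have "system_delta p q m \<alpha> \<beta> * lv t = (p * (p - 1 - \<alpha>) + q) * t
    - (p - 1) * (p - 1 - \<alpha>) * ln (Y t) - q * ln (Z t) - (p - 1 - \<alpha>) * ln (W t)"
    using p by (simp add: system_delta_def)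
  then have "lv t = ((p * (p - 1 - \<alpha>) + q) * t
    - (p - 1) * (p - 1 - \<alpha>) * ln (Y t) - q * ln (Z t) - (p - 1 - \<alpha>) * ln (W t))
      / system_delta p q m \<alpha> \<beta>"
    using delta by (simp add: eq_divide_eq mult.commute)
  then show ?thesis by (simp only: times_divide_eq_left diff_divide_distrib[symmetric])
qed

text \<open>The same linear system gives \<open>lP\<close>, and then the definition of \<open>ln X\<close> gives \<open>lu\<close>.\<close>
lemma lu_eq:
  "lu t = (1 + (p * (m + 1) - (1 + \<beta>)) / system_delta p q m \<alpha> \<beta>) * t
    - m * (p - 1) / system_delta p q m \<alpha> \<beta> * ln (Y t)
    - (p - 1 - \<beta>) / system_delta p q m \<alpha> \<beta> * ln (Z t)
    - m / system_delta p q m \<alpha> \<beta> * ln (W t) - ln (X t)"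
proof -
  have "lP t / a = (a - \<beta> + m * (a + 1)) / d * t
      - m * a / d * ln (Y t) - (a - \<beta>) / d * ln (Z t) - m / d * ln (W t)"
    if "a = p - 1" "s = p - 1 - \<alpha>" "d = s * (a - \<beta>) - q * m" "a > 0" "d > 0" for a s d
  proof -
    define x where "x = lP t / a"
    have Y: "a * ln (Y t) = a * t + lQ t - a * lv t"
      and Z: "ln (Z t) = t + m * lv t - s * x"
      and W: "ln (W t) = t + \<beta> * lv t + q * x - lQ t"
      using that by (simp_all add: Y_def Z_def W_def x_def distrib_left right_diff_distrib)
    have "d * x = (a - \<beta> + m * (a + 1)) * t
        - m * (a * t + lQ t - a * lv t) - (a - \<beta>) * ln (Z t) - m * ln (W t)"
      unfolding Z W that(3) by (simp add: algebra_simps)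
    then have "x = ((a - \<beta> + m * (a + 1)) * t
        - m * a * ln (Y t) - (a - \<beta>) * ln (Z t) - m * ln (W t)) / d"
      using \<open>d > 0\<close> unfolding Y[symmetric] by (simp add: eq_divide_eq mult.commute mult.left_commute)
    then show ?thesis
      by (simp only: x_def times_divide_eq_left diff_divide_distrib[symmetric])
  qed
  from this[of "p - 1" "p - 1 - \<alpha>" "system_delta p q m \<alpha> \<beta>"]
  have "lP t / (p - 1) = (p - 1 - \<beta> + m * p) / system_delta p q m \<alpha> \<beta> * t
    - m * (p - 1) / system_delta p q m \<alpha> \<beta> * ln (Y t)
    - (p - 1 - \<beta>) / system_delta p q m \<alpha> \<beta> * ln (Z t)
    - m / system_delta p q m \<alpha> \<beta> * ln (W t)"
    using p delta by (simp add: system_delta_def)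
  moreover have "lu t = t + lP t / (p - 1) - ln (X t)" by (simp add: X_def)
  moreover have "p - 1 - \<beta> + m * p = p * (m + 1) - (1 + \<beta>)" by (simp add: algebra_simps)
  ultimately show ?thesis by (simp add: distrib_right)
qed

lemma exp_lv_asymptotics:
  "((\<lambda>t. exp (lv t) / exp t powr ((p * (p - 1 - \<alpha>) + q) / system_delta p q m \<alpha> \<beta>))
    \<longlongrightarrow> B_lim N p q m \<alpha> \<beta>) at_top"
proof -
  have "exp (lv t) / exp t powr ((p * (p - 1 - \<alpha>) + q) / system_delta p q m \<alpha> \<beta>) =
      1 / (Y t powr ((p - 1) * (p - 1 - \<alpha>) / system_delta p q m \<alpha> \<beta>) *
        Z t powr (q / system_delta p q m \<alpha> \<beta>) *
        W t powr ((p - 1 - \<alpha>) / system_delta p q m \<alpha> \<beta>))" for t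
    using Y.pos[of t] Z.pos[of t] W.pos[of t]
    by (subst lv_eq) (simp add: powr_def exp_diff exp_add field_simps)
  moreover have "((\<lambda>t. 1 / (Y t powr ((p - 1) * (p - 1 - \<alpha>) / system_delta p q m \<alpha> \<beta>) *
        Z t powr (q / system_delta p q m \<alpha> \<beta>) *
        W t powr ((p - 1 - \<alpha>) / system_delta p q m \<alpha> \<beta>))) \<longlongrightarrow> B_lim N p q m \<alpha> \<beta>) at_top"
    unfolding B_lim_def Let_def
    by (intro tendsto_intros Y_tendsto Z_tendsto W_tendsto)
      (use Y\<^sub>e_pos Z_inf_pos W_inf_pos in auto)
  ultimately show ?thesis by simp
qed

lemma exp_lu_asymptotics:
  "((\<lambda>t. exp (lu t) / exp t powr (1 + (p * (m + 1) - (1 + \<beta>)) / system_delta p q m \<alpha> \<beta>))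
    \<longlongrightarrow> A_lim N p q m \<alpha> \<beta>) at_top"
proof -
  have "exp (lu t) / exp t powr (1 + (p * (m + 1) - (1 + \<beta>)) / system_delta p q m \<alpha> \<beta>) =
      1 / (Y t powr (m * (p - 1) / system_delta p q m \<alpha> \<beta>) *
        Z t powr ((p - 1 - \<beta>) / system_delta p q m \<alpha> \<beta>) *
        W t powr (m / system_delta p q m \<alpha> \<beta>) * X t)" for t
    using Y.pos[of t] Z.pos[of t] W.pos[of t] X.pos[of t]
    by (subst lu_eq) (simp add: powr_def exp_diff exp_add field_simps)
  moreover have "((\<lambda>t. 1 / (Y t powr (m * (p - 1) / system_delta p q m \<alpha> \<beta>) *
        Z t powr ((p - 1 - \<beta>) / system_delta p q m \<alpha> \<beta>) *
        W t powr (m / system_delta p q m \<alpha> \<beta>) * X t)) \<longlongrightarrow> A_lim N p q m \<alpha> \<beta>) at_top"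
    unfolding A_lim_def Let_def
    by (intro tendsto_intros Y_tendsto Z_tendsto W_tendsto X_tendsto)
      (use Y\<^sub>e_pos Z_inf_pos W_inf_pos X_inf_pos in auto)
  ultimately show ?thesis by simp
qed

end

section \<open>Radial solutions of p-Laplace equations\<close>

lemma GDERIV_unique:
  fixes f :: "'a::real_inner \<Rightarrow> real"
  assumes "GDERIV f x :> D" "GDERIV f x :> E"
  shows "D = E"
proof -
  have "(\<lambda>h. h \<bullet> D) = (\<lambda>h. h \<bullet> E)"
    using assms unfolding gderiv_def by (rule has_derivative_unique)
  then have "(D - E) \<bullet> D = (D - E) \<bullet> E" by meson
  then have "(D - E) \<bullet> (D - E) = 0" by (simp only: inner_diff_right)
  then show ?thesis by simp
qed

lemma grad_eq: "GDERIV f x :> D \<Longrightarrow> grad f x = D"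
  unfolding grad_def by (blast intro: GDERIV_unique)

lemma C2_GDERIV: "C2 f \<Longrightarrow> GDERIV f x :> grad f x"
  unfolding C2_def using grad_eq by metis

lemma has_divergence_unique:
  assumes "has_divergence F a x" "has_divergence F b x"
  shows "a = b"
  using assms has_derivative_unique unfolding has_divergence_def by metis

text \<open>Writing the field as \<open>Q y\<close> with the scalar factor \<open>Q = P(|y|) / |y|\<close>, its derivative is
  \<open>h \<mapsto> Q h + (dQ h) x\<close>, with trace \<open>N Q\<close> plus the derivative of \<open>Q\<close> in direction \<open>x\<close>.\<close>
lemma has_divergence_radial_field:
  fixes x :: "'a::euclidean_space"
  assumes "x \<noteq> 0" "(P has_real_derivative P') (at (norm x))"
  shows "has_divergence (\<lambda>y. P (norm y) *\<^sub>R sgn y) (P' + (DIM('a) - 1) / norm x * P (norm x)) x"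
proof -
  define r where "r = norm x"
  have r: "r > 0" using assms by (simp add: r_def)
  define Q' where "Q' = (P' * r - P r) / (r * r)"
  have "((\<lambda>s. P s / s) has_real_derivative Q') (at (norm x))"
    using DERIV_divide[OF assms(2) DERIV_ident] r by (simp add: Q'_def r_def)
  then have "GDERIV (\<lambda>y. P (norm y) / norm y) x :> Q' *\<^sub>R sgn x"
    by (rule GDERIV_DERIV_compose[OF GDERIV_norm[OF \<open>x \<noteq> 0\<close>]])
  then have D: "((\<lambda>y. (P (norm y) / norm y) *\<^sub>R y) has_derivative
      (\<lambda>h. (P r / r) *\<^sub>R h + (h \<bullet> (Q' *\<^sub>R sgn x)) *\<^sub>R x)) (at x)"
    unfolding gderiv_def r_def by (rule has_derivative_scaleR[OF _ has_derivative_ident])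
  have eq: "(\<lambda>y. (P (norm y) / norm y) *\<^sub>R y) = (\<lambda>y. P (norm y) *\<^sub>R sgn y)"
    by (simp add: sgn_div_norm divide_inverse)
  note D[unfolded eq]
  moreover have "(\<Sum>b\<in>Basis. ((P r / r) *\<^sub>R b + (b \<bullet> (Q' *\<^sub>R sgn x)) *\<^sub>R x) \<bullet> b)
      = P' + (DIM('a) - 1) / r * P r"
  proof -
    have "(\<Sum>b\<in>Basis. ((P r / r) *\<^sub>R b + (b \<bullet> (Q' *\<^sub>R sgn x)) *\<^sub>R x) \<bullet> b)
        = (\<Sum>b\<in>Basis. P r / r + Q' / r * ((x \<bullet> b) * (x \<bullet> b)))"
      by (rule sum.cong)
        (auto simp: inner_add_left inner_add_right sgn_div_norm r_def inner_commute divide_inverse)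
    also have "\<dots> = DIM('a) * (P r / r) + Q' / r * (x \<bullet> x)"
      by (simp add: sum.distrib sum_distrib_left euclidean_inner[of x x])
    also have "x \<bullet> x = r * r"
      by (simp add: r_def power2_norm_eq_inner[symmetric] power2_eq_square)
    also have "DIM('a) * (P r / r) + Q' / r * (r * r) = P' + (DIM('a) - 1) / r * P r"
      using r by (simp add: Q'_def field_simps)
    finally show ?thesis .
  qed
  ultimately show ?thesis
    unfolding has_divergence_def r_def[symmetric] by (intro exI conjI)
qed

text \<open>A radial function is studied along the ray through a fixed unit vector \<open>e\<close>. The ray is extended
  to a full line, so that \<open>profile\<close> is differentiable at \<open>0\<close> as well.\<close>
locale radial_function =
  fixes u :: "'a::euclidean_space \<Rightarrow> real" and e :: 'a
  assumes sym: "radially_symmetric u" and grad: "\<And>x. GDERIV u x :> grad u x"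
    and e: "norm e = 1"
begin

lemma e_nonzero: "e \<noteq> 0"
  using e by auto

definition profile :: "real \<Rightarrow> real" where "profile r = u (r *\<^sub>R e)"
definition slope :: "real \<Rightarrow> real" where "slope r = grad u (r *\<^sub>R e) \<bullet> e"

lemma eq_profile: "u x = profile (norm x)"
  using sym[unfolded radially_symmetric_def, rule_format, of x "norm x *\<^sub>R e"] e
  by (simp add: profile_def)

lemma profile_deriv: "(profile has_real_derivative slope r) (at r)"
proof -
  have "((\<lambda>r. r *\<^sub>R e) has_derivative (\<lambda>h. h *\<^sub>R e)) (at r)"
    by (rule has_derivative_scaleR_left[OF has_derivative_ident])
  from has_derivative_compose[OF this grad[unfolded gderiv_def]]
  have "((\<lambda>r. u (r *\<^sub>R e)) has_derivative (\<lambda>h. (h *\<^sub>R e) \<bullet> grad u (r *\<^sub>R e))) (at r)" .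
  then show ?thesis
    by (simp add: has_field_derivative_def profile_def[abs_def] slope_def inner_commute mult_commute_abs)
qed

lemma grad_radial:
  assumes "x \<noteq> 0"
  shows "grad u x = slope (norm x) *\<^sub>R sgn x"
proof (rule grad_eq)
  have "GDERIV (\<lambda>y. profile (norm y)) x :> slope (norm x) *\<^sub>R sgn x"
    by (rule GDERIV_DERIV_compose[OF GDERIV_norm[OF assms] profile_deriv])
  then show "GDERIV u x :> slope (norm x) *\<^sub>R sgn x"
    by (simp add: eq_profile[symmetric])
qed

lemma norm_grad:
  assumes "x \<noteq> 0"
  shows "norm (grad u x) = \<bar>slope (norm x)\<bar>"
  unfolding grad_radial[OF assms] using assms by (simp add: norm_sgn)

end

locale radial_p_Laplacian = radial_function u e
  for u :: "'a::euclidean_space \<Rightarrow> real" and e :: 'a +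
  fixes p :: real and rhs :: "'a \<Rightarrow> real"
  assumes p: "1 < p" and dim: "2 \<le> DIM('a)"
    and eq: "\<And>x. has_p_Laplacian p u (rhs x) x"
    and rhs_nonneg: "\<And>x. 0 \<le> rhs x"
    and nonconst: "nonconstant_near_0 u"
begin

definition flux :: "real \<Rightarrow> real" where "flux r = p_flux p u (r *\<^sub>R e) \<bullet> e"

lemma flux_eq: "0 < r \<Longrightarrow> flux r = \<bar>slope r\<bar> powr (p - 2) * slope r"
  using e e_nonzero norm_grad[of "r *\<^sub>R e"] by (auto simp: flux_def p_flux_def slope_def)

lemma p_flux_radial:
  assumes "x \<noteq> 0"
  shows "p_flux p u x = flux (norm x) *\<^sub>R sgn x"
  using assms unfolding p_flux_def norm_grad[OF assms] grad_radial[OF assms]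
  by (simp add: flux_eq norm_sgn)

text \<open>A solution makes the whole vector field \<open>p_flux\<close> differentiable, hence also its component along
  the ray.\<close>
lemma flux_differentiable: "\<exists>D. (flux has_real_derivative D) (at r)"
proof -
  obtain F' where F': "(p_flux p u has_derivative F') (at (r *\<^sub>R e))"
    using eq[of "r *\<^sub>R e"] unfolding has_p_Laplacian_def has_divergence_def by blast
  have "((\<lambda>r. r *\<^sub>R e) has_derivative (\<lambda>h. h *\<^sub>R e)) (at r)"
    by (rule has_derivative_scaleR_left[OF has_derivative_ident])
  from has_derivative_compose[OF this F']
  have "(flux has_derivative (\<lambda>h. F' (h *\<^sub>R e) \<bullet> e)) (at r)"
    unfolding flux_def by (rule has_derivative_inner_left)
  moreover have "F' (h *\<^sub>R e) \<bullet> e = (F' e \<bullet> e) * h" for h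
    using linear_scale[OF has_derivative_linear[OF F']] by simp
  ultimately show ?thesis by (auto simp: has_field_derivative_def)
qed

text \<open>The radial form \<open>P' + (N - 1) P / r = rhs\<close> of the equation: the divergence of the radial field
  with profile \<open>flux\<close> is computed in two ways.\<close>
lemma flux_deriv:
  assumes "0 < r"
  shows "(flux has_real_derivative rhs (r *\<^sub>R e) - (DIM('a) - 1) / r * flux r) (at r)"
proof -
  obtain D where D: "(flux has_real_derivative D) (at r)" using flux_differentiable by blast
  have x: "r *\<^sub>R e \<noteq> 0" "norm (r *\<^sub>R e) = r" using e assms by auto
  have "has_divergence (\<lambda>y. flux (norm y) *\<^sub>R sgn y) (D + (DIM('a) - 1) / r * flux r) (r *\<^sub>R e)"
    using has_divergence_radial_field[OF x(1), of flux D] D x by simp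
  moreover have "has_divergence (\<lambda>y. flux (norm y) *\<^sub>R sgn y) (rhs (r *\<^sub>R e)) (r *\<^sub>R e)"
  proof -
    obtain F' where F': "(p_flux p u has_derivative F') (at (r *\<^sub>R e))"
      "(\<Sum>b\<in>Basis. F' b \<bullet> b) = rhs (r *\<^sub>R e)"
      using eq[of "r *\<^sub>R e"] unfolding has_p_Laplacian_def has_divergence_def by blast
    have "((\<lambda>y. flux (norm y) *\<^sub>R sgn y) has_derivative F') (at (r *\<^sub>R e))"
      by (rule has_derivative_transform_within_open[OF F'(1), of "- {0}"])
        (use x p_flux_radial in auto)
    then show ?thesis using F'(2) unfolding has_divergence_def by blast
  qed
  ultimately have "D + (DIM('a) - 1) / r * flux r = rhs (r *\<^sub>R e)"
    by (rule has_divergence_unique)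
  then have "D = rhs (r *\<^sub>R e) - (DIM('a) - 1) / r * flux r" by simp
  then show ?thesis using D by simp
qed

text \<open>The equation says that \<open>r\<^sup>N\<^sup>-\<^sup>1 P\<close> has derivative \<open>r\<^sup>N\<^sup>-\<^sup>1 rhs \<ge> 0\<close>.\<close>
lemma weighted_flux_mono:
  assumes "0 \<le> r" "r \<le> s"
  shows "r ^ (DIM('a) - 1) * flux r \<le> s ^ (DIM('a) - 1) * flux s"
proof (rule DERIV_nonneg_imp_increasing_open[OF \<open>r \<le> s\<close>])
  fix x assume "r < x" "x < s"
  then have x: "0 < x" using assms by simp
  have "((\<lambda>r. r ^ (DIM('a) - 1) * flux r) has_real_derivative
      x ^ (DIM('a) - 1) * rhs (x *\<^sub>R e)) (at x)"
  proof -
    obtain k where k: "DIM('a) = 2 + k" using dim le_Suc_ex by blast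
    have "((\<lambda>r. r ^ (k + 1)) has_real_derivative (k + 1) * x ^ k) (at x)"
      using DERIV_pow[of "k + 1" x UNIV] by simp
    from DERIV_mult[OF this flux_deriv[OF x]]
    have "((\<lambda>r. r ^ (k + 1) * flux r) has_real_derivative
        (k + 1) * x ^ k * flux x + (rhs (x *\<^sub>R e) - (DIM('a) - 1) / x * flux x) * x ^ (k + 1)) (at x)" .
    also have "(k + 1) * x ^ k * flux x + (rhs (x *\<^sub>R e) - (DIM('a) - 1) / x * flux x) * x ^ (k + 1)
        = x ^ (k + 1) * rhs (x *\<^sub>R e)"
      using x by (simp add: k field_simps)
    finally show ?thesis using k by simp
  qed
  moreover have "0 \<le> x ^ (DIM('a) - 1) * rhs (x *\<^sub>R e)" using x rhs_nonneg by simp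
  ultimately show "\<exists>y. ((\<lambda>r. r ^ (DIM('a) - 1) * flux r) has_real_derivative y) (at x) \<and> 0 \<le> y"
    by blast
next
  have "continuous_on {r..s} flux"
    by (meson DERIV_isCont continuous_at_imp_continuous_on flux_differentiable)
  then show "continuous_on {r..s} (\<lambda>r. r ^ (DIM('a) - 1) * flux r)"
    by (intro continuous_intros)
qed

text \<open>The nondecreasing function \<open>r\<^sup>N\<^sup>-\<^sup>1 P\<close> vanishes at \<open>0\<close>. If it vanished again at some \<open>r > 0\<close>,
  it would vanish on \<open>[0, r]\<close>, and \<open>u\<close> would be constant in the ball of radius \<open>r\<close>.\<close>
lemma flux_pos:
  assumes "0 < r"
  shows "0 < flux r"
proof (rule ccontr)
  assume "\<not> 0 < flux r"
  have w0: "(0::real) ^ (DIM('a) - 1) * flux 0 = 0" using dim by simp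
  have zero: "slope s = 0" if s: "0 < s" "s \<le> r" for s
  proof -
    have "r ^ (DIM('a) - 1) * flux r \<le> 0"
      using \<open>\<not> 0 < flux r\<close> assms by (simp add: mult_le_0_iff)
    then have "s ^ (DIM('a) - 1) * flux s = 0"
      using weighted_flux_mono[of 0 s] weighted_flux_mono[of s r] w0 s by linarith
    then show ?thesis using s by (auto simp: flux_eq)
  qed
  have "profile s = profile 0" if s: "0 \<le> s" "s < r" for s
  proof (cases "s = 0")
    case False
    show ?thesis
    proof (rule DERIV_isconst2[where a = 0 and b = s])
      show "continuous_on {0..s} profile"
        by (meson DERIV_isCont continuous_at_imp_continuous_on profile_deriv)
      show "(profile has_real_derivative 0) (at x)" if "0 < x" "x < s" for x
        using profile_deriv[of x] zero[of x] that s by simp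
    qed (use False s in auto)
  qed simp
  then have "u constant_on ball 0 r"
    unfolding constant_on_def by (auto simp: eq_profile)
  then show False
    using nonconst assms unfolding nonconstant_near_0_def by (meson centre_in_ball open_ball)
qed

lemma slope_eq:
  assumes "0 < r"
  shows "slope r = flux r powr (1 / (p - 1))"
proof -
  have "0 < slope r"
    using flux_pos[OF assms] unfolding flux_eq[OF assms] by (simp add: zero_less_mult_iff)
  then have "flux r = slope r powr (p - 2 + 1)"
    unfolding flux_eq[OF assms] powr_add by simp
  then show ?thesis using \<open>0 < slope r\<close> p by (simp add: powr_powr)
qed

lemma grad_pow_eq:
  assumes "0 < r"
  shows "grad_pow u (r *\<^sub>R e) a = exp (a / (p - 1) * ln (flux r))"
proof -
  have "norm (grad u (r *\<^sub>R e)) = flux r powr (1 / (p - 1))"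
    using e e_nonzero assms norm_grad[of "r *\<^sub>R e"] slope_eq[of r] by auto
  then show ?thesis
    using flux_pos[OF assms] by (simp add: grad_pow_def powr_powr powr_def)
qed

lemma ln_flux_deriv:
  "((\<lambda>t. ln (flux (exp t))) has_real_derivative
    exp t * rhs (exp t *\<^sub>R e) / flux (exp t) - (DIM('a) - 1)) (at t)"
proof -
  have "((\<lambda>t. flux (exp t)) has_real_derivative
      (rhs (exp t *\<^sub>R e) - (DIM('a) - 1) / exp t * flux (exp t)) * exp t) (at t)"
    by (rule DERIV_chain2[OF flux_deriv DERIV_exp]) simp
  note deriv = DERIV_chain2[OF DERIV_ln_divide[OF flux_pos] this]
  show ?thesis
  proof (rule DERIV_cong[OF deriv])
    show "1 / flux (exp t) * ((rhs (exp t *\<^sub>R e) - (DIM('a) - 1) / exp t * flux (exp t)) * exp t)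
        = exp t * rhs (exp t *\<^sub>R e) / flux (exp t) - (DIM('a) - 1)"
      using flux_pos[of "exp t"] by (simp add: left_diff_distrib diff_divide_distrib)
  qed simp
qed

lemma ln_profile_deriv:
  assumes "\<And>x. 0 < u x"
  shows "((\<lambda>t. ln (profile (exp t))) has_real_derivative
    exp (t + ln (flux (exp t)) / (p - 1) - ln (profile (exp t)))) (at t)"
proof -
  have pos: "0 < profile (exp t)" using assms by (simp add: profile_def)
  have "((\<lambda>t. profile (exp t)) has_real_derivative slope (exp t) * exp t) (at t)"
    by (rule DERIV_chain2[OF profile_deriv DERIV_exp])
  from DERIV_chain2[OF DERIV_ln_divide[OF pos] this] show ?thesis
    using flux_pos[of "exp t"] pos
    by (simp add: slope_eq powr_def exp_add exp_diff field_simps)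
qed

end

section \<open>Asymptotics of the solutions\<close>

theorem theorem1p3:
  fixes u v :: "real ^ 'n \<Rightarrow> real"
    and p q m \<alpha> \<beta> \<delta> :: real
    and N :: nat
  assumes "N = CARD('n)" and "N \<ge> 2"
    and "1 < p" and "m > 0" and "q > 0"
    and "0 \<le> \<alpha>" and "\<alpha> < p - 1"
    and "0 \<le> \<beta>" and "\<beta> \<le> m"
    and "\<delta> = system_delta p q m \<alpha> \<beta>" and "\<delta> > 0"
    and "nonconstant_global_positive_radial_solution p q m \<alpha> \<beta> u v"
  shows "((\<lambda>x. u x / norm x powr (1 + (p * (m + 1) - (1 + \<beta>)) / \<delta>))
            \<longlongrightarrow> A_lim N p q m \<alpha> \<beta>) at_infinity
       \<and> ((\<lambda>x. v x / norm x powr ((p * (p - 1 - \<alpha>) + q) / \<delta>))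
            \<longlongrightarrow> B_lim N p q m \<alpha> \<beta>) at_infinity
       \<and> A_lim N p q m \<alpha> \<beta> > 0 \<and> B_lim N p q m \<alpha> \<beta> > 0"
proof -
  have N: "N = DIM(real ^ 'n)" using assms(1) by simp
  have sol: "C2 u" "C2 v" "\<And>x. 0 < u x" "\<And>x. 0 < v x" "radially_symmetric u" "radially_symmetric v"
    "nonconstant_near_0 u" "nonconstant_near_0 v" "solves_system p q m \<alpha> \<beta> u v"
    using assms(12) unfolding nonconstant_global_positive_radial_solution_def by auto
  obtain e :: "real ^ 'n" where e: "norm e = 1" using vector_choose_size[of 1] by auto
  interpret U: radial_p_Laplacian u e p "\<lambda>x. v x powr m * grad_pow u x \<alpha>"
    using sol e assms(2,3) N C2_GDERIV
    by unfold_locales (auto simp: solves_system_def grad_pow_def)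
  interpret V: radial_p_Laplacian v e p "\<lambda>x. v x powr \<beta> * grad_pow u x q"
    using sol e assms(2,3) N C2_GDERIV
    by unfold_locales (auto simp: solves_system_def grad_pow_def)
  have v_powr: "v (r *\<^sub>R e) powr a = exp (a * ln (V.profile r))" for r a
    using sol(4)[of "r *\<^sub>R e"] by (simp add: V.profile_def powr_def)
  interpret F: logarithmic_radial_flow N p q m \<alpha> \<beta>
    "\<lambda>t. ln (U.profile (exp t))" "\<lambda>t. ln (V.profile (exp t))"
    "\<lambda>t. ln (U.flux (exp t))" "\<lambda>t. ln (V.flux (exp t))"
  proof
    fix t :: real
    show "((\<lambda>t. ln (U.profile (exp t))) has_real_derivative
        exp (t + ln (U.flux (exp t)) / (p - 1) - ln (U.profile (exp t)))) (at t)"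
      by (rule U.ln_profile_deriv[OF sol(3)])
    show "((\<lambda>t. ln (V.profile (exp t))) has_real_derivative
        exp (t + ln (V.flux (exp t)) / (p - 1) - ln (V.profile (exp t)))) (at t)"
      by (rule V.ln_profile_deriv[OF sol(4)])
    have P: "1 / U.flux (exp t) = exp (- ln (U.flux (exp t)))"
      and Q: "1 / V.flux (exp t) = exp (- ln (V.flux (exp t)))"
      using U.flux_pos[of "exp t"] V.flux_pos[of "exp t"] by (simp_all add: exp_minus divide_inverse)
    have "exp t * (v (exp t *\<^sub>R e) powr m * grad_pow u (exp t *\<^sub>R e) \<alpha>) / U.flux (exp t)
        = exp t * (v (exp t *\<^sub>R e) powr m * grad_pow u (exp t *\<^sub>R e) \<alpha>) * (1 / U.flux (exp t))"
      by simp
    also have "\<dots> = exp (t + m * ln (V.profile (exp t)) + (\<alpha> / (p - 1) - 1) * ln (U.flux (exp t)))"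
      unfolding P v_powr U.grad_pow_eq[OF exp_gt_zero] exp_add[symmetric]
      by (simp add: algebra_simps)
    also have "\<alpha> / (p - 1) - 1 = - ((p - 1 - \<alpha>) / (p - 1))"
      using assms(3) by (simp add: diff_divide_distrib)
    finally show "((\<lambda>t. ln (U.flux (exp t))) has_real_derivative
        exp (t + m * ln (V.profile (exp t)) - (p - 1 - \<alpha>) / (p - 1) * ln (U.flux (exp t)))
        - (real N - 1)) (at t)"
      using U.ln_flux_deriv[of t] N by simp
    have "exp t * (v (exp t *\<^sub>R e) powr \<beta> * grad_pow u (exp t *\<^sub>R e) q) / V.flux (exp t)
        = exp t * (v (exp t *\<^sub>R e) powr \<beta> * grad_pow u (exp t *\<^sub>R e) q) * (1 / V.flux (exp t))"
      by simp
    also have "\<dots> = exp (t + \<beta> * ln (V.profile (exp t)) + q / (p - 1) * ln (U.flux (exp t))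
        - ln (V.flux (exp t)))"
      unfolding Q v_powr U.grad_pow_eq[OF exp_gt_zero] exp_add[symmetric]
      by (simp add: algebra_simps)
    finally show "((\<lambda>t. ln (V.flux (exp t))) has_real_derivative
        exp (t + \<beta> * ln (V.profile (exp t)) + q / (p - 1) * ln (U.flux (exp t))
        - ln (V.flux (exp t))) - (real N - 1)) (at t)"
      using V.ln_flux_deriv[of t] N by simp
  qed (use assms in auto)
  have lim: "filterlim (\<lambda>x::real ^ 'n. ln (norm x)) at_top at_infinity"
    by (rule filterlim_compose[OF ln_at_top filterlim_norm_at_top])
  \<comment> \<open>The limits in \<open>t\<close> are composed with \<open>t = ln |x|\<close>, which makes sense for \<open>x \<noteq> 0\<close> only.\<close>
  have limit_in_x: "((\<lambda>x. f x / norm x powr c) \<longlongrightarrow> L) at_infinity"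
    if f: "\<And>x. f x = g (norm x)" "\<And>x. 0 < f x"
      and L: "((\<lambda>t. exp (ln (g (exp t))) / exp t powr c) \<longlongrightarrow> L) at_top"
    for f :: "real ^ 'n \<Rightarrow> real" and g c L
  proof (rule Lim_transform_eventually[OF filterlim_compose[OF L lim]])
    have "\<forall>\<^sub>F x::real ^ 'n in at_infinity. 0 < norm x"
      using filterlim_norm_at_top[where 'a = "real ^ 'n"] eventually_gt_at_top[of "0::real"]
      unfolding filterlim_iff by blast
    then show "\<forall>\<^sub>F x in at_infinity. exp (ln (g (exp (ln (norm x))))) / exp (ln (norm x)) powr c
        = f x / norm x powr c"
      by eventually_elim (use f(2) in \<open>simp add: f(1)[symmetric]\<close>)
  qed
  show ?thesis
    unfolding assms(10)
    by (intro conjI limit_in_x[where g = U.profile, OF U.eq_profile sol(3)]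
        limit_in_x[where g = V.profile, OF V.eq_profile sol(4)]
        F.exp_lu_asymptotics F.exp_lv_asymptotics F.A_lim_pos F.B_lim_pos)
qed

end
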